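(* Let $q$ be a prime power, let $1\le k\le n$ be integers, and let $V$ be an $n$-dimensional vector space over $\mathbb{F}_q$. If $\mathcal{F}\subsetneq\mathrm{Gr}_k(V)$, then $$|\mathcal{F}|\ge\frac{\binom{n}{1}_q}{\binom{k}{1}_q^{2}}\,\sigma_{k,q}(\mathcal{F}).$$ Equality can hold only if all points of $V$ have the same degree in $\mathcal{F}$, i.e. $d_{\mathcal{F}}(x)$ is the same for all $x\in\mathrm{Gr}_1(V)$.
   Context: $\binom{a}{b}_q$ is the Gaussian coefficient; in particular $\binom{a}{1}_q=\frac{q^a-1}{q-1}$. $\mathrm{Gr}_k(V)$ is the set of all $k$-dimensional subspaces of $V$; the elements of $\mathrm{Gr}_1(V)$ are called points. For a point $x$, $d_{\mathcal{F}}(x)=|\{F\in\mathcal{F}:x\le F\}|$; for $S\in\mathrm{Gr}_k(V)$, $d_{\mathcal{F}}(S)=\sum_{x\in\mathrm{Gr}_1(S)}d_{\mathcal{F}}(x)$. For $\mathcal{F}\ne\mathrm{Gr}_k(V)$ the projective Ore-degree is $\sigma_{k,q}(\mathcal{F})=\min\{d_{\mathcal{F}}(S):S\in\mathrm{Gr}_k(V)\setminus\mathcal{F}\}$. *)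

theory Defs
  imports Complex_Main "HOL-Library.Cardinality"
begin

(* For b > a the factor with i = a vanishes, so the coefficient is 0 as usual. *)
definition gauss_coeff :: "nat \<Rightarrow> nat \<Rightarrow> nat \<Rightarrow> real" where
  "gauss_coeff q a b = (\<Prod>i<b. (real q ^ (a - i) - 1) / (real q ^ (b - i) - 1))"

lemma gauss_coeff_1: "gauss_coeff q a 1 = (real q ^ a - 1) / (real q - 1)"
  by (simp add: gauss_coeff_def)

(* The k-dimensional subspaces of V, for a vector space with scalar multiplication scale.
   The library's dim is 0 on spaces without a finite basis, so for k = 0 this would also
   contain infinite-dimensional subspaces if V has any; for k > 0 it is as expected. *)
definition Gr :: "('a::field \<Rightarrow> 'v::ab_group_add \<Rightarrow> 'v) \<Rightarrow> nat \<Rightarrow> 'v set \<Rightarrow> 'v set set" where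
  "Gr scale k V = {S. module.subspace scale S \<and> S \<subseteq> V \<and> vector_space.dim scale S = k}"

definition point_degree :: "'v set set \<Rightarrow> 'v set \<Rightarrow> nat" where
  "point_degree \<F> x = card {S \<in> \<F>. x \<subseteq> S}"

definition subspace_degree ::
  "('a::field \<Rightarrow> 'v::ab_group_add \<Rightarrow> 'v) \<Rightarrow> 'v set set \<Rightarrow> 'v set \<Rightarrow> nat" where
  "subspace_degree scale \<F> S = (\<Sum>x\<in>Gr scale 1 S. point_degree \<F> x)"

(* Only meaningful when \<F> is a proper subfamily of Gr scale k V and the latter is finite:
   Min is unspecified on empty and on infinite sets. *)
definition ore_degree ::
  "('a::field \<Rightarrow> 'v::ab_group_add \<Rightarrow> 'v) \<Rightarrow> nat \<Rightarrow> 'v set \<Rightarrow> 'v set set \<Rightarrow> nat" where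
  "ore_degree scale k V \<F> = Min {subspace_degree scale \<F> S | S. S \<in> Gr scale k V - \<F>}"

end

theory Submission imports Defs begin

text \<open>
  Write \<open>p\<close> for the number of points of \<open>V\<close>, \<open>c\<close> for the number of points of a \<open>k\<close>-dimensional
  subspace and \<open>N\<close> for the number of these subspaces. The argument is double counting together
  with Cauchy--Schwarz, and the only geometry in it is that points and \<open>k\<close>-dimensional subspaces
  form a tactical configuration: every block carries the same number \<open>c\<close> of points, and every
  point lies in the same number \<open>r = N c / p\<close> of blocks.

  Summing \<open>d(S)\<close> over all blocks gives \<open>r c |\<F>|\<close>, whereas summing it over the blocks in \<open>\<F>\<close>
  gives the sum of the squares \<open>d(x)\<^sup>2\<close>, which is at least \<open>c\<^sup>2 |\<F>|\<^sup>2 / p\<close>. The difference is the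
  sum over the \<open>N - |\<F>|\<close> blocks outside \<open>\<F>\<close>, each term of which is at least \<open>\<sigma>\<close>; therefore
  \<open>\<sigma> (N - |\<F>|) \<le> (c\<^sup>2 / p) |\<F>| (N - |\<F>|)\<close>. Cancelling \<open>N - |\<F>| > 0\<close> yields the bound, and
  equality forces equality in Cauchy--Schwarz, that is, constant point degrees.

  \<open>tactical_configuration_ore_bound\<close> is this counting argument. Its two hypotheses are supplied
  by \<open>card_points\<close>, because the nonzero vectors are partitioned by the points, and by
  \<open>card_subspaces_through_point_eq\<close>, because the linear automorphisms of \<open>V\<close> are transitive on
  points.
\<close>

section \<open>The degree bound for tactical configurations\<close>

text \<open>
  Carrying along the sum \<open>Q\<close> of the squared deviations of the degrees from their mean \<open>\<mu>\<close>,
  instead of quoting Cauchy--Schwarz, gives, with \<open>N = |B|\<close>,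
  \<open>(N - |F|) (c\<^sup>2 |F| / |P| - s) \<ge> Q \<ge> 0\<close>, from which the bound and the case of equality are both
  read off.
\<close>

lemma tactical_configuration_ore_bound:
  fixes P :: "'p set" and B F :: "'b set" and I :: "'p \<Rightarrow> 'b \<Rightarrow> bool" and c r s :: nat
  defines "d \<equiv> \<lambda>x. card {b \<in> F. I x b}"
  assumes finP: "finite P" and "P \<noteq> {}" and finB: "finite B" and FB: "F \<subset> B"
    and c: "\<And>b. b \<in> B \<Longrightarrow> card {x \<in> P. I x b} = c"
    and r: "\<And>x. x \<in> P \<Longrightarrow> card {b \<in> B. I x b} = r"
    and s: "\<And>b. b \<in> B - F \<Longrightarrow> s \<le> (\<Sum>x | x \<in> P \<and> I x b. d x)"
  shows "real s \<le> (real c)\<^sup>2 / card P * card F"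
    and "real s = (real c)\<^sup>2 / card P * card F \<Longrightarrow> \<forall>x\<in>P. \<forall>y\<in>P. d x = d y"
proof -
  define D where "D b = (\<Sum>x | x \<in> P \<and> I x b. d x)" for b
  define p f N where "p = real (card P)" and "f = real (card F)" and "N = real (card B)"
  define \<mu> where "\<mu> = c * f / p"
  define Q where "Q = (\<Sum>x\<in>P. (d x - \<mu>)\<^sup>2)"
  have finF: "finite F" using finB FB finite_subset by blast
  have p: "p > 0" using finP \<open>P \<noteq> {}\<close> by (simp add: p_def card_gt_0_iff)
  have Nf: "N - f > 0" using psubset_card_mono[OF finB FB] by (simp add: N_def f_def)
  have "r * card P = (\<Sum>x\<in>P. card {b \<in> B. I x b})" using r by simp
  also have "\<dots> = c * card B" using c by (intro sum_multicount finP finB) auto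
  finally have rp: "r * p = c * N"
    unfolding p_def N_def by (metis of_nat_mult)
  have sum_d: "(\<Sum>x\<in>P. d x) = c * card F"
    unfolding d_def using c FB by (intro sum_multicount finP finF) auto
  have "sum D B = (\<Sum>x\<in>P. \<Sum>b | b \<in> B \<and> I x b. d x)"
    unfolding D_def using sum.swap_restrict[OF finP finB, of "\<lambda>x b. d x" I] by simp
  also have "\<dots> = r * (c * card F)"
    by (simp add: r flip: sum_d sum_distrib_left)
  finally have DB: "real (sum D B) = r * c * f" by (simp add: f_def)
  have "sum D F = (\<Sum>x\<in>P. \<Sum>b | b \<in> F \<and> I x b. d x)"
    unfolding D_def using sum.swap_restrict[OF finP finF, of "\<lambda>x b. d x" I] by simp
  also have "\<dots> = (\<Sum>x\<in>P. (d x)\<^sup>2)"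
    by (simp add: d_def power2_eq_square)
  finally have DF: "real (sum D F) = (\<Sum>x\<in>P. (real (d x))\<^sup>2)" by simp
  have sum_dr: "(\<Sum>x\<in>P. real (d x)) = c * f"
    using arg_cong[OF sum_d, of real] by (simp add: f_def)
  have "Q = (\<Sum>x\<in>P. (real (d x))\<^sup>2 - 2 * \<mu> * d x + \<mu>\<^sup>2)"
    unfolding Q_def by (simp add: power2_diff algebra_simps)
  also have "\<dots> = (\<Sum>x\<in>P. (real (d x))\<^sup>2) - 2 * \<mu> * (c * f) + p * \<mu>\<^sup>2"
    by (simp add: sum.distrib sum_subtractf p_def flip: sum_dr sum_distrib_left)
  also have "\<dots> = (\<Sum>x\<in>P. (real (d x))\<^sup>2) - (c * f)\<^sup>2 / p"
    using p by (simp add: \<mu>_def power2_eq_square)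
  finally have DF': "real (sum D F) = Q + (c * f)\<^sup>2 / p" using DF by simp
  have "s * card (B - F) \<le> sum D (B - F)"
    using sum_mono[of "B - F" "\<lambda>_. s" D] s by (simp add: D_def mult.commute)
  then have "real (s * card (B - F)) \<le> real (sum D (B - F))" by linarith
  moreover have "real (card (B - F)) = N - f"
    using FB finF finB by (simp add: card_Diff_subset card_mono of_nat_diff N_def f_def psubset_imp_subset)
  moreover have "real (sum D B) = real (sum D (B - F)) + real (sum D F)"
    using sum.subset_diff[of F B D] FB finB by auto
  ultimately have "s * (N - f) \<le> r * c * f - (Q + (c * f)\<^sup>2 / p)"
    using DB DF' by simp
  also have "\<dots> = c * N / p * c * f - (Q + (c * f)\<^sup>2 / p)"
    using rp p by (simp add: eq_divide_eq)
  also have "\<dots> = (real c)\<^sup>2 / p * f * (N - f) - Q"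
    using p by (simp add: field_simps power2_eq_square)
  finally have key: "Q \<le> (N - f) * ((real c)\<^sup>2 / p * f - s)" by (simp add: algebra_simps)
  have Q0: "Q \<ge> 0" unfolding Q_def by (intro sum_nonneg) auto
  show "real s \<le> (real c)\<^sup>2 / card P * card F"
    using key Q0 Nf zero_le_mult_iff[of "N - f" "(real c)\<^sup>2 / p * f - s"]
    unfolding p_def f_def by linarith
  show "\<forall>x\<in>P. \<forall>y\<in>P. d x = d y" if "real s = (real c)\<^sup>2 / card P * card F"
  proof -
    have "Q = 0" using key Q0 that by (simp add: p_def f_def)
    then have "\<forall>x\<in>P. (d x - \<mu>)\<^sup>2 = 0"
      unfolding Q_def using finP by (subst (asm) sum_nonneg_eq_0_iff) auto
    then have "\<forall>x\<in>P. real (d x) = \<mu>" by simp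
    then show ?thesis by (metis of_nat_eq_iff)
  qed
qed

section \<open>Subspaces over a finite field\<close>

context vector_space
begin

lemma card_span_independent:
  assumes "finite (UNIV :: 'a set)" and "finite B" and "independent B"
  shows "finite (span B) \<and> card (span B) = CARD('a) ^ card B"
  using assms(2,3)
proof (induction B rule: finite_induct)
  case empty
  then show ?case by simp
next
  case (insert a B)
  then have a: "a \<notin> span B" and B: "independent B"
    by (simp_all add: independent_insert)
  let ?g = "\<lambda>(k, w). scale k a + w"
  have inj: "inj_on ?g (UNIV \<times> span B)"
  proof (rule inj_onI, clarify)
    fix k l w w' assume w: "w \<in> span B" "w' \<in> span B" and eq: "scale k a + w = scale l a + w'"
    then have "scale (k - l) a = w' - w" by (simp add: algebra_simps)
    then have "scale (k - l) a \<in> span B" using w by (simp add: span_diff)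
    then have "k = l"
      using a span_scale[of "scale (k - l) a" B "inverse (k - l)"] by (cases "k = l") auto
    then show "k = l \<and> w = w'" using eq by simp
  qed
  have "span (insert a B) = ?g ` (UNIV \<times> span B)"
  proof (intro subset_antisym subsetI)
    fix z assume "z \<in> span (insert a B)"
    then obtain k where "z - scale k a \<in> span B" by (auto simp: span_insert)
    then show "z \<in> ?g ` (UNIV \<times> span B)" by (intro image_eqI[of _ _ "(k, z - scale k a)"]) auto
  next
    fix z assume "z \<in> ?g ` (UNIV \<times> span B)"
    then obtain k w where z: "z = scale k a + w" and w: "w \<in> span B" by auto
    have "z - scale k a \<in> span B" using w by (simp add: z)
    then show "z \<in> span (insert a B)" unfolding span_insert by blast
  qed
  then show ?case
    using insert B inj assms(1) by (simp add: card_image card_cartesian_product)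
qed

lemma two_le_card_field: "finite (UNIV :: 'a set) \<Longrightarrow> 2 \<le> CARD('a)"
  using card_mono[of "UNIV :: 'a set" "{0, 1}"] by simp

lemma card_subspace:
  assumes "finite (UNIV :: 'a set)" and "subspace W" and "finite W"
  shows "card W = CARD('a) ^ dim W"
proof -
  obtain B where B: "B \<subseteq> W" "independent B" "W \<subseteq> span B" "card B = dim W"
    using basis_exists by blast
  have "span B = W" using B assms(2) by (simp add: span_minimal subset_antisym)
  then show ?thesis using card_span_independent[of B] B assms finite_subset by metis
qed

text \<open>
  Counting vectors detects the dimension, so a linear bijection preserves dimension simply
  because it preserves cardinality.
\<close>

lemma dim_eq_iff_card:
  assumes "finite (UNIV :: 'a set)" and "subspace W" and "finite W"
  shows "dim W = d \<longleftrightarrow> card W = CARD('a) ^ d"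
  using card_subspace[OF assms] two_le_card_field[OF assms(1)] by simp

text \<open>The value \<open>0\<close> of \<open>dim\<close> on spaces without a finite basis is excluded by the first hypothesis.\<close>

lemma finite_subspace_if_dim_pos:
  assumes "0 < dim V" and "finite (UNIV :: 'a set)" and "subspace V"
  shows "finite V"
proof -
  obtain B where B: "B \<subseteq> V" "independent B" "V \<subseteq> span B" "card B = dim V"
    using basis_exists by blast
  have "finite B" using B(4) assms(1) by (intro card_ge_0_finite) simp
  then show ?thesis using card_span_independent[of B] B assms finite_subset by blast
qed

section \<open>Points and blocks\<close>

lemma Gr_1_eq_span:
  assumes "finite (UNIV :: 'a set)" and "finite W" and "x \<in> Gr scale 1 W" and "w \<in> x" and "w \<noteq> 0"
  shows "x = span {w}"
proof -
  have x: "subspace x" "x \<subseteq> W" "dim x = 1" using assms(3) by (auto simp: Gr_def)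
  then have "finite x" using assms(2) finite_subset by blast
  moreover have "span {w} \<subseteq> x" using x assms(4) by (simp add: span_minimal)
  moreover have "card (span {w}) = card x"
    using card_span_independent[of "{w}"] card_subspace[OF assms(1) x(1) \<open>finite x\<close>] assms x
    by simp
  ultimately show ?thesis by (metis card_subset_eq)
qed

lemma Gr_1_generator:
  assumes "finite (UNIV :: 'a set)" and "finite W" and "x \<in> Gr scale 1 W"
  obtains w where "w \<in> W" and "w \<noteq> 0" and "x = span {w}"
proof -
  have x: "subspace x" "x \<subseteq> W" "dim x = 1" using assms(3) by (auto simp: Gr_def)
  have "x \<noteq> {0}" using x(3) dim_span_eq_card_independent[OF independent_empty] by auto
  then obtain w where "w \<in> x" "w \<noteq> 0" using x(1) subspace_0 by blast
  with that x Gr_1_eq_span[OF assms] show ?thesis by blast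
qed

lemma span_in_Gr_1: "subspace W \<Longrightarrow> w \<in> W \<Longrightarrow> w \<noteq> 0 \<Longrightarrow> span {w} \<in> Gr scale 1 W"
  using dim_span_eq_card_independent[of "{w}"] by (simp add: Gr_def span_minimal)

text \<open>
  Each of the \<open>q^d - 1\<close> nonzero vectors of \<open>W\<close> generates exactly one point, and each point is
  generated by its \<open>q - 1\<close> nonzero vectors.
\<close>

lemma card_points:
  assumes fin: "finite (UNIV :: 'a set)" and W: "subspace W" "finite W"
  shows "real (card (Gr scale 1 W)) = gauss_coeff (CARD('a)) (dim W) 1"
proof -
  let ?G = "Gr scale 1 W" and ?q = "CARD('a)"
  have finG: "finite ?G" using W(2) by (auto simp: Gr_def intro: finite_subset[of _ "Pow W"])
  have card_point: "card (x - {0}) = ?q - 1" if "x \<in> ?G" for x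
  proof -
    have x: "subspace x" "x \<subseteq> W" "dim x = 1" using that by (auto simp: Gr_def)
    then show ?thesis
      using card_subspace[OF fin x(1)] W(2) finite_subset[OF x(2)] subspace_0[OF x(1)]
      by (simp add: card_Diff_singleton)
  qed
  have "W - {0} = (\<Union>x\<in>?G. x - {0})"
  proof (intro subset_antisym subsetI)
    fix w assume "w \<in> W - {0}"
    then show "w \<in> (\<Union>x\<in>?G. x - {0})"
      using span_in_Gr_1[OF W(1), of w] span_base[of w "{w}"] by blast
  qed (auto simp: Gr_def)
  moreover have "card (\<Union>x\<in>?G. x - {0}) = (\<Sum>x\<in>?G. card (x - {0}))"
  proof (rule card_UN_disjoint[OF finG])
    show "\<forall>x\<in>?G. finite (x - {0})"
      using W(2) by (auto simp: Gr_def intro: finite_subset)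
    show "\<forall>x\<in>?G. \<forall>y\<in>?G. x \<noteq> y \<longrightarrow> (x - {0}) \<inter> (y - {0}) = {}"
      using Gr_1_eq_span[OF fin W(2)] by blast
  qed
  ultimately have "card (W - {0}) = card ?G * (?q - 1)" using card_point by simp
  then have "?q ^ dim W - 1 = card ?G * (?q - 1)"
    using card_subspace[OF fin W] subspace_0[OF W(1)] by (simp add: card_Diff_singleton W(2))
  then have "real (?q ^ dim W - 1) = real (card ?G) * real (?q - 1)" by simp
  then show ?thesis
    using two_le_card_field[OF fin] by (simp add: gauss_coeff_def of_nat_diff field_simps)
qed

text \<open>
  Extend the generators of two distinct points to a basis of \<open>V\<close> and exchange them: this linear
  involution of \<open>V\<close> swaps the two points.
\<close>

lemma involution_swapping_points:
  assumes fin: "finite (UNIV :: 'a set)" and V: "subspace V" "finite V"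
    and xy: "x \<in> Gr scale 1 V" "y \<in> Gr scale 1 V" "x \<noteq> y"
  obtains f where "Vector_Spaces.linear scale scale f" and "f ` V = V" and "\<And>z. z \<in> V \<Longrightarrow> f (f z) = z"
    and "f ` x = y" and "f ` y = x"
proof -
  interpret vector_space_pair scale scale by unfold_locales
  obtain u where u: "u \<in> V" "u \<noteq> 0" "x = span {u}" using Gr_1_generator[OF fin V(2) xy(1)] .
  obtain v where v: "v \<in> V" "v \<noteq> 0" "y = span {v}" using Gr_1_generator[OF fin V(2) xy(2)] .
  have "u \<noteq> v" using u v xy by auto
  have "v \<notin> span {u}" using Gr_1_eq_span[OF fin V(2) xy(1)] u v xy by metis
  then have "independent {v, u}" using u by (simp add: independent_insert independent_empty)
  then obtain B where B: "{v, u} \<subseteq> B" "B \<subseteq> V" "independent B" "V \<subseteq> span B"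
    using maximal_independent_subset_extend[of "{v, u}" V] u v by blast
  have VB: "V = span B" using B V(1) by (simp add: span_minimal subset_antisym)
  define \<tau> where "\<tau> b = (if b = u then v else if b = v then u else b)" for b
  obtain f where f: "Vector_Spaces.linear scale scale f" and f\<tau>: "\<And>b. b \<in> B \<Longrightarrow> f b = \<tau> b"
    using linear_independent_extend[OF B(3)] by blast
  interpret f: Vector_Spaces.linear scale scale f by fact
  have "f ` B = \<tau> ` B" using f\<tau> by simp
  also have "\<dots> = B" using B(1) \<open>u \<noteq> v\<close> by (auto simp: \<tau>_def image_iff split: if_splits)
  finally have "f ` V = V" using f.span_image[of B] VB by simp
  moreover have "f (f z) = z" if "z \<in> V" for z
  proof -
    have "(f \<circ> f) z = id z"
    proof (rule linear_eq_on[where f = "f \<circ> f" and g = id and B = B])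
      show "Vector_Spaces.linear scale scale (f \<circ> f)" using f f by (rule Vector_Spaces.linear_compose)
      show "Vector_Spaces.linear scale scale id" by (rule linear_id)
      show "z \<in> span B" using that VB by simp
      show "(f \<circ> f) b = id b" if "b \<in> B" for b
        using that B(1) by (auto simp: f\<tau> \<tau>_def)
    qed
    then show ?thesis by simp
  qed
  moreover have "f u = v" "f v = u" using B(1) \<open>u \<noteq> v\<close> by (auto simp: f\<tau> \<tau>_def)
  then have "f ` x = y" "f ` y = x" using f.span_image[of "{u}"] f.span_image[of "{v}"] u v by auto
  ultimately show ?thesis using that f by blast
qed

lemma card_subspaces_through_point_eq:
  assumes fin: "finite (UNIV :: 'a set)" and V: "subspace V" "finite V"
    and xy: "x \<in> Gr scale 1 V" "y \<in> Gr scale 1 V"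
  shows "card {S \<in> Gr scale k V. x \<subseteq> S} = card {S \<in> Gr scale k V. y \<subseteq> S}"
proof (cases "x = y")
  case False
  obtain f where f: "Vector_Spaces.linear scale scale f" "f ` V = V" "\<And>z. z \<in> V \<Longrightarrow> f (f z) = z"
    "f ` x = y" "f ` y = x"
    using involution_swapping_points[OF fin V xy False] by blast
  interpret f: Vector_Spaces.linear scale scale f by fact
  have inj: "inj_on f V" using f(3) by (rule inj_on_inverseI)
  have ff: "f ` f ` S = S" if "S \<subseteq> V" for S
    using that f(3) by (force simp: image_image subset_iff)
  have Gr: "f ` S \<in> Gr scale k V" if "S \<in> Gr scale k V" for S
  proof -
    have S: "subspace S" "S \<subseteq> V" "dim S = k" using that by (auto simp: Gr_def)
    have "finite S" using S(2) V(2) finite_subset by blast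
    moreover have "card (f ` S) = card S" using inj S(2) by (meson card_image inj_on_subset)
    moreover have "subspace (f ` S)" using S(1) by (rule f.subspace_image)
    ultimately have "dim (f ` S) = k" using S dim_eq_iff_card[OF fin] by simp
    then show ?thesis using \<open>subspace (f ` S)\<close> S(2) f(2) by (auto simp: Gr_def)
  qed
  have "bij_betw ((`) f) {S \<in> Gr scale k V. x \<subseteq> S} {S \<in> Gr scale k V. y \<subseteq> S}"
  proof (rule bij_betw_byWitness[where f' = "(`) f"])
    show "\<forall>S\<in>{S \<in> Gr scale k V. x \<subseteq> S}. f ` f ` S = S" "\<forall>S\<in>{S \<in> Gr scale k V. y \<subseteq> S}. f ` f ` S = S"
      using ff by (auto simp: Gr_def)
    show "(`) f ` {S \<in> Gr scale k V. x \<subseteq> S} \<subseteq> {S \<in> Gr scale k V. y \<subseteq> S}"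
      using Gr f(4) by blast
    show "(`) f ` {S \<in> Gr scale k V. y \<subseteq> S} \<subseteq> {S \<in> Gr scale k V. x \<subseteq> S}"
      using Gr f(5) by blast
  qed
  then show ?thesis by (rule bij_betw_same_card)
qed simp

end

theorem lemma2p4:
  fixes scale :: "'a::{field,finite} \<Rightarrow> 'v::ab_group_add \<Rightarrow> 'v"
    and V :: "'v set" and \<F> :: "'v set set" and q k n :: nat
  assumes "vector_space scale"
    and "q = CARD('a)"
    and "1 \<le> k" and "k \<le> n"
    and "module.subspace scale V" and "vector_space.dim scale V = n"
    and "\<F> \<subset> Gr scale k V"
  shows "real (card \<F>) \<ge>
           gauss_coeff q n 1 / (gauss_coeff q k 1)\<^sup>2 * real (ore_degree scale k V \<F>)
       \<and> (real (card \<F>) =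
           gauss_coeff q n 1 / (gauss_coeff q k 1)\<^sup>2 * real (ore_degree scale k V \<F>)
         \<longrightarrow> (\<forall>x\<in>Gr scale 1 V. \<forall>y\<in>Gr scale 1 V.
               point_degree \<F> x = point_degree \<F> y))"
proof -
  interpret vector_space scale by fact
  have fin: "finite (UNIV :: 'a set)" by simp
  note V = assms(5)
  have finV: "finite V" using finite_subspace_if_dim_pos[OF _ fin V] assms(3,4,6) by simp
  let ?P = "Gr scale 1 V" and ?B = "Gr scale k V"
  have fins: "finite ?P" "finite ?B"
    using finV by (auto simp: Gr_def intro: finite_subset[of _ "Pow V"])
  have q: "q \<ge> 2" using two_le_card_field[OF fin] assms(2) by simp
  have pos: "gauss_coeff q m 1 > 0" if "m \<ge> 1" for m
    using q that one_less_power[of "real q" m] by (simp add: gauss_coeff_def)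
  have cardP: "real (card ?P) = gauss_coeff q n 1"
    using card_points[OF fin V finV] assms(2,6) by simp
  then have "card ?P > 0" using pos[of n] assms(3,4) by simp
  then obtain x\<^sub>0 where x0: "x\<^sub>0 \<in> ?P" by fastforce
  have points: "{x \<in> ?P. x \<subseteq> S} = Gr scale 1 S" if "S \<in> ?B" for S
    using that by (auto simp: Gr_def)
  have c: "real (card {x \<in> ?P. x \<subseteq> S}) = gauss_coeff q k 1" if "S \<in> ?B" for S
    using that card_points[OF fin, of S] finite_subset[OF _ finV, of S] assms(2)
    unfolding points[OF that] by (auto simp: Gr_def)
  obtain S\<^sub>0 where S0: "S\<^sub>0 \<in> ?B" using assms(7) by blast
  define c where "c = card {x \<in> ?P. x \<subseteq> S\<^sub>0}"
  have c_eq: "real c = gauss_coeff q k 1" using c[OF S0] by (simp add: c_def)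
  have card_c: "card {x \<in> ?P. x \<subseteq> S} = c" if "S \<in> ?B" for S
    using c[OF that] c_eq by simp
  have ore: "ore_degree scale k V \<F> \<le> (\<Sum>x | x \<in> ?P \<and> x \<subseteq> S. card {T \<in> \<F>. x \<subseteq> T})"
    if "S \<in> ?B - \<F>" for S
  proof -
    have "ore_degree scale k V \<F> \<le> subspace_degree scale \<F> S"
      unfolding ore_degree_def using that fins(2) by (intro Min_le) auto
    then show ?thesis using points[of S] that by (simp add: subspace_degree_def point_degree_def)
  qed
  note bound = tactical_configuration_ore_bound[where I = "(\<subseteq>)",
      OF fins(1) _ fins(2) assms(7) card_c
        card_subspaces_through_point_eq[OF fin V finV _ x0] ore]
  have "?P \<noteq> {}" using x0 by blast
  note bound = bound(1)[OF this] bound(2)[OF this]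
  have pos': "gauss_coeff q n 1 > 0" "gauss_coeff q k 1 > 0" using pos assms(3,4) by auto
  let ?a = "gauss_coeff q n 1 / (gauss_coeff q k 1)\<^sup>2"
  have "?a > 0" using pos' by simp
  have iff: "?a * real (ore_degree scale k V \<F>) = real (card \<F>) \<longleftrightarrow>
      real (ore_degree scale k V \<F>) = (gauss_coeff q k 1)\<^sup>2 / gauss_coeff q n 1 * real (card \<F>)"
    using pos' by (auto simp: divide_simps mult.commute)
  have "?a * real (ore_degree scale k V \<F>)
      \<le> ?a * ((gauss_coeff q k 1)\<^sup>2 / gauss_coeff q n 1 * real (card \<F>))"
    using bound(1) \<open>?a > 0\<close> unfolding c_eq cardP by (intro mult_left_mono) auto
  also have "\<dots> = real (card \<F>)" using pos' by simp
  finally have "?a * real (ore_degree scale k V \<F>) \<le> real (card \<F>)" .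
  moreover have "\<forall>x\<in>?P. \<forall>y\<in>?P. point_degree \<F> x = point_degree \<F> y"
    if "real (card \<F>) = ?a * real (ore_degree scale k V \<F>)"
    unfolding point_degree_def
    by (rule bound(2), assumption+, unfold c_eq cardP) (rule iffD1[OF iff that[symmetric]])
  ultimately show ?thesis by blast
qed

end
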